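(* Let $\omega_0,\alpha,\omega_d,h,H>0$, $J_0=\begin{bmatrix}0&\omega_0\\-\omega_0&0\end{bmatrix}$, $\tilde\Lambda=\begin{bmatrix}0&0\\0&-\frac{\alpha}{2}\end{bmatrix}$. Then the origin of the system on $\mathbb{R}\times\mathbb{R}^2\times\mathbb{R}$ $$\dot r=-hr+H\bar z^\top(J_0+\tilde\Lambda e^{\hat d})\bar z,\qquad \dot{\bar z}=(J_0+\tilde\Lambda)\bar z+(e^{\hat d}-1)\tilde\Lambda\bar z,\qquad \dot{\hat d}=-\omega_d(e^{\hat d}-1)$$ is globally uniformly asymptotically stable. *)

theory Defs
  imports "HOL-Analysis.Analysis"
begin

text \<open>A solution of the autonomous ODE x' = f x on the forward interval [t0, \<infinity>).\<close>
definition is_solution :: "('a::real_normed_vector \<Rightarrow> 'a) \<Rightarrow> real \<Rightarrow> (real \<Rightarrow> 'a) \<Rightarrow> bool" where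
  "is_solution f t0 x \<longleftrightarrow>
     (\<forall>t\<ge>t0. (x has_vector_derivative f (x t)) (at t within {t0..}))"

text \<open>Global uniform asymptotic stability of the origin (Khalil-style):
  the origin is an equilibrium, solutions exist forward in time from every initial state,
  uniform stability, uniform global boundedness, uniform global attractivity.\<close>
definition GUAS :: "('a::real_normed_vector \<Rightarrow> 'a) \<Rightarrow> bool" where
  "GUAS f \<longleftrightarrow>
     f 0 = 0 \<and>
     (\<forall>t0 x0. \<exists>x. x t0 = x0 \<and> is_solution f t0 x) \<and>
     (\<forall>\<epsilon>>0. \<exists>\<delta>>0. \<forall>t0 x. is_solution f t0 x \<and> norm (x t0) < \<delta> \<longrightarrow>
                             (\<forall>t\<ge>t0. norm (x t) < \<epsilon>)) \<and>
     (\<forall>c>0. \<exists>B. \<forall>t0 x. is_solution f t0 x \<and> norm (x t0) < c \<longrightarrow>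
                             (\<forall>t\<ge>t0. norm (x t) \<le> B)) \<and>
     (\<forall>c>0. \<forall>\<eta>>0. \<exists>T\<ge>0. \<forall>t0 x. is_solution f t0 x \<and> norm (x t0) < c \<longrightarrow>
                             (\<forall>t\<ge>t0 + T. norm (x t) < \<eta>))"

definition J0 :: "real \<Rightarrow> real^2^2" where
  "J0 \<omega>0 = vector [vector [0, \<omega>0], vector [- \<omega>0, 0]]"

definition LambdaT :: "real \<Rightarrow> real^2^2" where
  "LambdaT \<alpha> = vector [vector [0, 0], vector [0, - \<alpha> / 2]]"

text \<open>The vector field on R \<times> R^2 \<times> R, state (r, z, d).\<close>
definition sysf :: "real \<Rightarrow> real \<Rightarrow> real \<Rightarrow> real \<Rightarrow> real \<Rightarrow>
                    real \<times> (real^2) \<times> real \<Rightarrow> real \<times> (real^2) \<times> real" where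
  "sysf \<omega>0 \<alpha> \<omega>d h H = (\<lambda>(r, z, d).
     (- h * r + H * (z \<bullet> ((J0 \<omega>0 + exp d *\<^sub>R LambdaT \<alpha>) *v z)),
      (J0 \<omega>0 + LambdaT \<alpha>) *v z + (exp d - 1) *\<^sub>R (LambdaT \<alpha> *v z),
      - \<omega>d * (exp d - 1)))"

end

theory Submission
  imports Defs "HOL-Real_Asymp.Real_Asymp"
begin

(*
  The equation for d is decoupled and explicitly solvable: exp (- d) - 1 decays like
  exp (- \<omega>d t), so |d| never exceeds its initial value and tends to 0 exponentially.
  The equation for z is then a harmonic oscillator z1' = \<omega>0 z2, z2' = - \<omega>0 z1 - A(t) z2
  whose damping A = \<alpha> exp d / 2 stays between two positive constants fixed by the size of
  the initial state; |z|\<^sup>2 is nonincreasing, and the strict Lyapunov function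
  |z|\<^sup>2 + \<epsilon> z1 z2 yields exponential decay at a rate depending only on those constants.
  Finally (|z|\<^sup>2)' = - 2 Q, where Q = \<alpha> exp d z2\<^sup>2 / 2 is exactly the forcing in the
  equation for r, so r - H |z|\<^sup>2 / 2 obeys a linear equation driven by |z|\<^sup>2 alone and
  r decays as well. Together this gives a class-K bound and a uniform decay bound, i.e. GUAS.
  Solutions exist since d is explicit, z solves a linear equation with bounded continuous
  coefficients (Picard series) and r an affine scalar one (variation of constants).
*)

section \<open>Differential inequalities on a half-line\<close>

lemma DERIV_atLeast_nonpos_imp_nonincreasing:
  fixes f f' :: "real \<Rightarrow> real"
  assumes deriv: "\<And>t. t \<ge> a \<Longrightarrow> (f has_real_derivative f' t) (at t within {a..})"
    and nonpos: "\<And>t. t \<ge> a \<Longrightarrow> f' t \<le> 0"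
    and "a \<le> s" "s \<le> t"
  shows "f t \<le> f s"
proof -
  have "\<exists>u\<in>{s..t}. f t - f s = f' u * (t - s)"
  proof (rule mvt_very_simple[where f'="\<lambda>u h. f' u * h"])
    fix u assume "s \<le> u" "u \<le> t"
    then have "(f has_real_derivative f' u) (at u within {s..t})"
      using deriv[of u] \<open>a \<le> s\<close> by (auto intro: DERIV_subset)
    then show "(f has_derivative (\<lambda>h. f' u * h)) (at u within {s..t})"
      by (simp add: has_field_derivative_def)
  qed (use assms in auto)
  then obtain u where "u \<in> {s..t}" "f t - f s = f' u * (t - s)" by auto
  moreover have "f' u * (t - s) \<le> 0"
    using nonpos[of u] \<open>u \<in> {s..t}\<close> assms by (auto intro: mult_nonpos_nonneg)
  ultimately show ?thesis by linarith
qed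

lemma DERIV_atLeast_zero_imp_constant:
  fixes f :: "real \<Rightarrow> real"
  assumes "\<And>t. t \<ge> a \<Longrightarrow> (f has_real_derivative 0) (at t within {a..})" and "a \<le> t"
  shows "f t = f a"
proof -
  have "f t \<le> f a"
    by (rule DERIV_atLeast_nonpos_imp_nonincreasing) (use assms in auto)
  moreover have "- f t \<le> - f a"
    by (rule DERIV_atLeast_nonpos_imp_nonincreasing[where f' = "\<lambda>_. 0"])
       (use assms in \<open>auto intro!: derivative_eq_intros\<close>)
  ultimately show ?thesis by linarith
qed

lemma DERIV_atLeast_le_imp_exp_decay:
  fixes f f' :: "real \<Rightarrow> real"
  assumes deriv: "\<And>t. t \<ge> a \<Longrightarrow> (f has_real_derivative f' t) (at t within {a..})"
    and decay: "\<And>t. t \<ge> a \<Longrightarrow> f' t \<le> - k * f t" and "a \<le> t"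
  shows "f t \<le> f a * exp (- k * (t - a))"
proof -
  define g where "g t = f t * exp (k * (t - a))" for t
  have "g t \<le> g a"
  proof (rule DERIV_atLeast_nonpos_imp_nonincreasing[where f = g and a = a])
    fix s assume "a \<le> s"
    show "(g has_real_derivative (f' s + k * f s) * exp (k * (s - a))) (at s within {a..})"
      unfolding g_def using deriv[OF \<open>a \<le> s\<close>]
      by (auto intro!: derivative_eq_intros simp: algebra_simps)
    show "(f' s + k * f s) * exp (k * (s - a)) \<le> 0"
      using decay[OF \<open>a \<le> s\<close>] by (simp add: mult_nonpos_nonneg)
  qed (use assms in auto)
  then have "f t * exp (k * (t - a)) * exp (- k * (t - a)) \<le> f a * exp (- k * (t - a))"
    by (simp add: g_def)
  then show ?thesis by (simp add: mult.assoc flip: exp_add)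
qed

lemma DERIV_atLeast_relaxation_bounds:
  fixes f g :: "real \<Rightarrow> real"
  assumes deriv: "\<And>t. t \<ge> a \<Longrightarrow> (f has_real_derivative - h * (f t + g t)) (at t within {a..})"
    and g: "\<And>t. t \<ge> a \<Longrightarrow> 0 \<le> g t \<and> g t \<le> G" and "h \<ge> 0" "a \<le> t"
  shows "f t \<le> f a * exp (- h * (t - a))"
    and "(f a + G) * exp (- h * (t - a)) - G \<le> f t"
proof -
  show "f t \<le> f a * exp (- h * (t - a))"
  proof (rule DERIV_atLeast_le_imp_exp_decay[where f = f and a = a, OF deriv])
    show "- h * (f s + g s) \<le> - h * f s" if "a \<le> s" for s
      using g[OF that] \<open>h \<ge> 0\<close> by (simp add: algebra_simps)
  qed (use assms in auto)
  have "- (f t + G) \<le> - (f a + G) * exp (- h * (t - a))"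
  proof (rule DERIV_atLeast_le_imp_exp_decay[where f = "\<lambda>t. - (f t + G)" and a = a])
    fix s assume "a \<le> s"
    show "((\<lambda>t. - (f t + G)) has_real_derivative h * (f s + g s)) (at s within {a..})"
      using deriv[OF \<open>a \<le> s\<close>] by (auto intro!: derivative_eq_intros)
    show "h * (f s + g s) \<le> - h * - (f s + G)"
      using g[OF \<open>a \<le> s\<close>] \<open>h \<ge> 0\<close> mult_left_mono[of "g s" G h] by (simp add: algebra_simps)
  qed fact
  then show "(f a + G) * exp (- h * (t - a)) - G \<le> f t" by (simp add: algebra_simps)
qed

lemma forced_relaxation_abs_le:
  fixes r N Q :: "real \<Rightarrow> real"
  assumes Dr: "\<And>t. t \<ge> t0 \<Longrightarrow> (r has_real_derivative - h * r t - H * Q t) (at t within {t0..})"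
    and DN: "\<And>t. t \<ge> t0 \<Longrightarrow> (N has_real_derivative - 2 * Q t) (at t within {t0..})"
    and Q: "\<And>t. t \<ge> t0 \<Longrightarrow> Q t \<ge> 0" and N: "\<And>t. t \<ge> t0 \<Longrightarrow> N t \<ge> 0"
    and "h \<ge> 0" "H \<ge> 0" "t0 \<le> t1" "t1 \<le> t"
  shows "\<bar>r t\<bar> \<le> (\<bar>r t1\<bar> + H / 2 * N t1) * exp (- h * (t - t1)) + H * N t1"
proof -
  \<comment> \<open>Since \<open>N' = - 2 * Q\<close>, the forcing cancels: \<open>W' = - h * (W + H / 2 * N)\<close>.\<close>
  define W where "W t = r t - H / 2 * N t" for t
  have DW: "(W has_real_derivative - h * (W s + H / 2 * N s)) (at s within {t1..})" if "t1 \<le> s" for s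
  proof -
    have "(W has_real_derivative (- h * r s - H * Q s) - H / 2 * (- 2 * Q s)) (at s within {t0..})"
      unfolding W_def using Dr[of s] DN[of s] that \<open>t0 \<le> t1\<close> by (auto intro!: derivative_eq_intros)
    moreover have "(- h * r s - H * Q s) - H / 2 * (- 2 * Q s) = - h * (W s + H / 2 * N s)"
      by (simp add: W_def algebra_simps)
    ultimately show ?thesis
      using \<open>t0 \<le> t1\<close> by (auto intro: DERIV_subset)
  qed
  have N_le: "N s \<le> N t1" if "t1 \<le> s" for s
    using DERIV_atLeast_nonpos_imp_nonincreasing[OF DN] Q that \<open>t0 \<le> t1\<close> by fastforce
  have "0 \<le> H / 2 * N s \<and> H / 2 * N s \<le> H / 2 * N t1" if "t1 \<le> s" for s
    using N[of s] N_le[OF that] that assms by (simp add: mult_left_mono)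
  note W_bounds = DERIV_atLeast_relaxation_bounds[OF DW this \<open>h \<ge> 0\<close> \<open>t1 \<le> t\<close>]
  define e where "e = exp (- h * (t - t1))"
  have "0 \<le> e" by (simp add: e_def)
  have "r t1 * e \<le> \<bar>r t1\<bar> * e" "- (r t1 * e) \<le> \<bar>r t1\<bar> * e"
    using mult_right_mono[OF abs_ge_self \<open>0 \<le> e\<close>] mult_right_mono[OF abs_ge_minus_self \<open>0 \<le> e\<close>]
    by simp_all
  moreover have "0 \<le> H * (N t1 * e)" "0 \<le> H * N t" "H * N t \<le> H * N t1"
    using N[of t1] N[of t] N_le[of t] assms \<open>0 \<le> e\<close> by (simp_all add: mult_left_mono)
  ultimately show ?thesis
    using W_bounds unfolding W_def e_def[symmetric] abs_le_iff by (simp add: algebra_simps)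
qed

section \<open>The relaxation equation \<open>d' = - \<omega> * (exp d - 1)\<close>\<close>

lemma abs_le_abs_exp_minus_one_mult_exp: "\<bar>x :: real\<bar> \<le> \<bar>exp x - 1\<bar> * exp \<bar>x\<bar>"
proof (cases "x \<ge> 0")
  case True
  have "x \<le> exp x - 1" using exp_ge_add_one_self[of x] by linarith
  also have "\<dots> \<le> (exp x - 1) * exp x" using True by (simp add: mult_le_cancel_left1)
  finally show ?thesis using True by simp
next
  case False
  have "- x \<le> exp (- x) - 1" using exp_ge_add_one_self[of "- x"] by linarith
  also have "\<dots> = (1 - exp x) * exp (- x)" by (simp add: algebra_simps exp_minus_inverse)
  finally show ?thesis using False by (simp add: abs_if)
qed

lemma exp_relaxation_closed_form:
  fixes d :: "real \<Rightarrow> real"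
  assumes deriv: "\<And>t. t \<ge> t0 \<Longrightarrow> (d has_real_derivative - \<omega> * (exp (d t) - 1)) (at t within {t0..})"
    and "t0 \<le> t"
  shows "exp (- d t) - 1 = (exp (- d t0) - 1) * exp (- \<omega> * (t - t0))"
proof -
  define g where "g t = (exp (- d t) - 1) * exp (\<omega> * (t - t0))" for t
  have "g t = g t0"
  proof (rule DERIV_atLeast_zero_imp_constant[where f = g])
    fix s assume "t0 \<le> s"
    have "(g has_real_derivative exp (- d s) * (\<omega> * (exp (d s) - 1)) * exp (\<omega> * (s - t0))
        + (exp (- d s) - 1) * (\<omega> * exp (\<omega> * (s - t0)))) (at s within {t0..})"
      unfolding g_def using deriv[OF \<open>t0 \<le> s\<close>] by (auto intro!: derivative_eq_intros)
    moreover have "exp (- d s) * (\<omega> * (exp (d s) - 1)) * exp (\<omega> * (s - t0))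
        + (exp (- d s) - 1) * (\<omega> * exp (\<omega> * (s - t0))) = 0"
      by (simp add: algebra_simps flip: exp_add)
    ultimately show "(g has_real_derivative 0) (at s within {t0..})" by simp
  qed fact
  then have "(exp (- d t) - 1) * exp (\<omega> * (t - t0)) * exp (- \<omega> * (t - t0))
      = (exp (- d t0) - 1) * exp (- \<omega> * (t - t0))"
    by (simp add: g_def)
  then show ?thesis by (simp add: mult.assoc flip: exp_add)
qed

lemma exp_relaxation_abs_le:
  fixes d :: "real \<Rightarrow> real"
  assumes deriv: "\<And>t. t \<ge> t0 \<Longrightarrow> (d has_real_derivative - \<omega> * (exp (d t) - 1)) (at t within {t0..})"
    and "\<omega> \<ge> 0" "t0 \<le> t"
  shows "\<bar>d t\<bar> \<le> \<bar>d t0\<bar>"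
proof -
  define q where "q = exp (- \<omega> * (t - t0))"
  have q: "0 \<le> q" "q \<le> 1" using assms by (auto simp: q_def mult_nonneg_nonneg)
  have eq: "exp (- d t) = 1 + (exp (- d t0) - 1) * q"
    using exp_relaxation_closed_form[OF deriv \<open>t0 \<le> t\<close>] by (simp add: q_def)
  show ?thesis
  proof (cases "d t0 \<ge> 0")
    case True
    then have "(exp (- d t0) - 1) * (1 - q) \<le> 0" "(exp (- d t0) - 1) * q \<le> 0"
      using q by (auto intro: mult_nonpos_nonneg)
    moreover have "(exp (- d t0) - 1) * (1 - q) = exp (- d t0) - 1 - (exp (- d t0) - 1) * q"
      by (simp add: algebra_simps)
    ultimately have "exp (- d t0) \<le> exp (- d t)" "exp (- d t) \<le> exp 0"
      unfolding eq exp_zero by linarith+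
    then show ?thesis using True by auto
  next
    case False
    then have "0 \<le> (exp (- d t0) - 1) * (1 - q)" "0 \<le> (exp (- d t0) - 1) * q"
      using q by auto
    moreover have "(exp (- d t0) - 1) * (1 - q) = exp (- d t0) - 1 - (exp (- d t0) - 1) * q"
      by (simp add: algebra_simps)
    ultimately have "exp (- d t) \<le> exp (- d t0)" "exp 0 \<le> exp (- d t)"
      unfolding eq exp_zero by linarith+
    then show ?thesis using False by auto
  qed
qed

lemma exp_relaxation_exp_decay:
  fixes d :: "real \<Rightarrow> real"
  assumes deriv: "\<And>t. t \<ge> t0 \<Longrightarrow> (d has_real_derivative - \<omega> * (exp (d t) - 1)) (at t within {t0..})"
    and "\<omega> \<ge> 0" "t0 \<le> t"
  shows "\<bar>d t\<bar> \<le> exp (2 * \<bar>d t0\<bar>) * exp (- \<omega> * (t - t0))"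
proof -
  have "exp (- d t0) \<le> exp \<bar>d t0\<bar>" "1 \<le> exp \<bar>d t0\<bar>" by auto
  then have "\<bar>exp (- d t0) - 1\<bar> \<le> exp \<bar>d t0\<bar>"
    using exp_gt_zero[of "- d t0"] by (simp only: abs_le_iff) linarith
  have "\<bar>d t\<bar> \<le> \<bar>exp (- d t) - 1\<bar> * exp \<bar>d t\<bar>"
    using abs_le_abs_exp_minus_one_mult_exp[of "- d t"] by simp
  also have "\<dots> \<le> \<bar>exp (- d t) - 1\<bar> * exp \<bar>d t0\<bar>"
    using exp_relaxation_abs_le[OF assms] by (intro mult_left_mono) auto
  also have "\<bar>exp (- d t) - 1\<bar> = \<bar>exp (- d t0) - 1\<bar> * exp (- \<omega> * (t - t0))"
    using exp_relaxation_closed_form[OF deriv \<open>t0 \<le> t\<close>] by (simp add: abs_mult)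
  also have "\<dots> \<le> exp \<bar>d t0\<bar> * exp (- \<omega> * (t - t0))"
    using \<open>\<bar>exp (- d t0) - 1\<bar> \<le> exp \<bar>d t0\<bar>\<close> by (intro mult_right_mono) auto
  finally show ?thesis by (simp add: mult_ac flip: exp_add)
qed

lemma exp_relaxation_exists:
  assumes "\<omega> \<ge> 0"
  obtains d :: "real \<Rightarrow> real" where "d t0 = d0"
    "\<And>t. t \<ge> t0 \<Longrightarrow> (d has_real_derivative - \<omega> * (exp (d t) - 1)) (at t within {t0..})"
proof -
  define u where "u t = 1 + (exp (- d0) - 1) * exp (- \<omega> * (t - t0))" for t
  define d where "d t = - ln (u t)" for t
  have "(d has_real_derivative - \<omega> * (exp (d t) - 1)) (at t within {t0..})" if "t0 \<le> t" for t
  proof -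
    define q where "q = exp (- \<omega> * (t - t0))"
    have "0 < q" "q \<le> 1" using assms that by (auto simp: q_def mult_nonneg_nonneg)
    then have "0 < (1 - q) + q * exp (- d0)" by (simp add: add_nonneg_pos)
    then have "u t > 0" by (simp add: u_def q_def algebra_simps)
    then have "(d has_real_derivative - ((exp (- d0) - 1) * (exp (- \<omega> * (t - t0)) * (- \<omega>)) / u t))
        (at t within {t0..})"
      unfolding d_def[abs_def] u_def[abs_def] by (auto intro!: derivative_eq_intros simp: u_def)
    then show ?thesis
    proof (rule DERIV_cong)
      have "- ((exp (- d0) - 1) * (exp (- \<omega> * (t - t0)) * (- \<omega>)) / u t) = \<omega> * (u t - 1) / u t"
        by (simp add: u_def)
      also have "\<dots> = - \<omega> * (1 / u t - 1)" using \<open>u t > 0\<close> by (simp add: field_simps)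
      also have "1 / u t = exp (d t)" using \<open>u t > 0\<close> by (simp add: d_def exp_minus inverse_eq_divide)
      finally show "- ((exp (- d0) - 1) * (exp (- \<omega> * (t - t0)) * (- \<omega>)) / u t) = - \<omega> * (exp (d t) - 1)" .
    qed
  qed
  moreover have "d t0 = d0" by (simp add: d_def u_def)
  ultimately show ?thesis using that by blast
qed

section \<open>A harmonic oscillator with bounded damping\<close>

lemma damped_oscillator_energy_nonincreasing:
  fixes z1 z2 A :: "real \<Rightarrow> real"
  assumes D1: "\<And>t. t \<ge> t0 \<Longrightarrow> (z1 has_real_derivative \<omega> * z2 t) (at t within {t0..})"
    and D2: "\<And>t. t \<ge> t0 \<Longrightarrow> (z2 has_real_derivative - \<omega> * z1 t - A t * z2 t) (at t within {t0..})"
    and damping: "\<And>t. t \<ge> t0 \<Longrightarrow> A t \<ge> 0" and "t0 \<le> s" "s \<le> t"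
  shows "(z1 t)\<^sup>2 + (z2 t)\<^sup>2 \<le> (z1 s)\<^sup>2 + (z2 s)\<^sup>2"
proof (rule DERIV_atLeast_nonpos_imp_nonincreasing[where f = "\<lambda>t. (z1 t)\<^sup>2 + (z2 t)\<^sup>2" and a = t0])
  fix u assume "t0 \<le> u"
  show "((\<lambda>t. (z1 t)\<^sup>2 + (z2 t)\<^sup>2) has_real_derivative - 2 * A u * (z2 u)\<^sup>2) (at u within {t0..})"
    using D1[OF \<open>t0 \<le> u\<close>] D2[OF \<open>t0 \<le> u\<close>]
    by (auto intro!: derivative_eq_intros simp: algebra_simps power2_eq_square)
  show "- 2 * A u * (z2 u)\<^sup>2 \<le> 0" using damping[OF \<open>t0 \<le> u\<close>] by simp
qed (use assms in auto)

lemma damped_oscillator_lyapunov_ineq: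
  fixes x y A \<omega> \<epsilon> \<kappa> :: real
  assumes "\<omega> > 0" "\<epsilon> \<ge> 0" "2 * \<epsilon> * \<omega> \<le> A" "\<epsilon> * A \<le> \<omega>" "\<kappa> \<le> A" "\<kappa> \<le> \<epsilon> * \<omega> / 2"
  shows "- 2 * A * y\<^sup>2 + \<epsilon> * (\<omega> * y\<^sup>2 - \<omega> * x\<^sup>2 - A * x * y) \<le> - \<kappa> * (x\<^sup>2 + y\<^sup>2)"
proof -
  have "0 \<le> 2 * \<epsilon> * \<omega>" using assms by simp
  then have "A \<ge> 0" using assms by linarith
  have "0 \<le> \<epsilon> / (2 * \<omega>) * (\<omega> * x + A * y)\<^sup>2" using assms by simp
  also have "\<dots> = \<epsilon> * \<omega> / 2 * x\<^sup>2 + \<epsilon> * A * x * y + \<epsilon> * A * A / (2 * \<omega>) * y\<^sup>2"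
    using \<open>\<omega> > 0\<close> by (simp add: power2_eq_square field_simps)
  finally have "- \<epsilon> * A * x * y \<le> \<epsilon> * \<omega> / 2 * x\<^sup>2 + \<epsilon> * A * A / (2 * \<omega>) * y\<^sup>2" by simp
  moreover have "\<epsilon> * A * A / (2 * \<omega>) * y\<^sup>2 \<le> A / 2 * y\<^sup>2"
  proof -
    have "\<epsilon> * A * A \<le> \<omega> * A" using assms \<open>A \<ge> 0\<close> by (intro mult_right_mono) auto
    then show ?thesis using \<open>\<omega> > 0\<close> by (intro mult_right_mono) (auto simp: field_simps)
  qed
  moreover have "\<epsilon> * \<omega> * y\<^sup>2 \<le> A / 2 * y\<^sup>2" "\<kappa> * x\<^sup>2 \<le> \<epsilon> * \<omega> / 2 * x\<^sup>2" "\<kappa> * y\<^sup>2 \<le> A * y\<^sup>2"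
    using mult_right_mono[of "\<epsilon> * \<omega>" "A / 2" "y\<^sup>2"] mult_right_mono[of \<kappa> "\<epsilon> * \<omega> / 2" "x\<^sup>2"]
      mult_right_mono[of \<kappa> A "y\<^sup>2"] assms
    by simp_all
  ultimately show ?thesis by (simp add: algebra_simps)
qed

lemma damped_oscillator_lyapunov_decay:
  fixes z1 z2 A :: "real \<Rightarrow> real"
  assumes D1: "\<And>t. t \<ge> t0 \<Longrightarrow> (z1 has_real_derivative \<omega> * z2 t) (at t within {t0..})"
    and D2: "\<And>t. t \<ge> t0 \<Longrightarrow> (z2 has_real_derivative - \<omega> * z1 t - A t * z2 t) (at t within {t0..})"
    and "\<omega> > 0" "0 < \<epsilon>" "\<epsilon> \<le> 1 / 2" "\<kappa> > 0"
    and A: "\<And>t. t \<ge> t0 \<Longrightarrow> 2 * \<epsilon> * \<omega> \<le> A t \<and> \<epsilon> * A t \<le> \<omega> \<and> \<kappa> \<le> A t"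
    and "\<kappa> \<le> \<epsilon> * \<omega> / 2" "t0 \<le> t"
  shows "(z1 t)\<^sup>2 + (z2 t)\<^sup>2 \<le> 5 / 3 * ((z1 t0)\<^sup>2 + (z2 t0)\<^sup>2) * exp (- (4 / 5 * \<kappa>) * (t - t0))"
proof -
  define N where "N t = (z1 t)\<^sup>2 + (z2 t)\<^sup>2" for t
  \<comment> \<open>The damping acts on \<open>z2\<close> only; the cross term makes \<open>V\<close> a strict Lyapunov function.\<close>
  define V where "V t = N t + \<epsilon> * z1 t * z2 t" for t
  have V_N: "3 / 4 * N s \<le> V s" "V s \<le> 5 / 4 * N s" for s
  proof -
    have "2 * \<bar>z1 s * z2 s\<bar> \<le> N s"
      using sum_squares_bound[of "\<bar>z1 s\<bar>" "\<bar>z2 s\<bar>"] by (simp add: N_def abs_mult)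
    then have "\<bar>\<epsilon> * z1 s * z2 s\<bar> \<le> 1 / 4 * N s"
      using assms mult_mono[of \<epsilon> "1/2" "2 * \<bar>z1 s * z2 s\<bar>" "N s"] by (auto simp: abs_mult)
    then show "3 / 4 * N s \<le> V s" "V s \<le> 5 / 4 * N s"
      unfolding V_def by (simp_all only: abs_le_iff) linarith+
  qed
  have "V t \<le> V t0 * exp (- (4 / 5 * \<kappa>) * (t - t0))"
  proof (rule DERIV_atLeast_le_imp_exp_decay[where f = V and a = t0])
    fix s assume "t0 \<le> s"
    let ?V' = "- 2 * A s * (z2 s)\<^sup>2 + \<epsilon> * (\<omega> * (z2 s)\<^sup>2 - \<omega> * (z1 s)\<^sup>2 - A s * z1 s * z2 s)"
    show "(V has_real_derivative ?V') (at s within {t0..})"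
      unfolding V_def N_def using D1[OF \<open>t0 \<le> s\<close>] D2[OF \<open>t0 \<le> s\<close>]
      by (auto intro!: derivative_eq_intros simp: algebra_simps power2_eq_square)
    have "?V' \<le> - \<kappa> * N s"
      unfolding N_def using A[OF \<open>t0 \<le> s\<close>] assms
      by (intro damped_oscillator_lyapunov_ineq) auto
    also have "\<dots> \<le> - (4 / 5 * \<kappa>) * V s"
      using V_N(2)[of s] \<open>\<kappa> > 0\<close> by simp
    finally show "?V' \<le> - (4 / 5 * \<kappa>) * V s" .
  qed fact
  also have "\<dots> \<le> 5 / 4 * N t0 * exp (- (4 / 5 * \<kappa>) * (t - t0))"
    using V_N(2)[of t0] by (intro mult_right_mono) auto
  finally show ?thesis
    using V_N(1)[of t] by (simp add: N_def)
qed

lemma damped_oscillator_exp_decay: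
  fixes \<omega> amin amax :: real
  assumes "\<omega> > 0" "amin > 0" "amin \<le> amax"
  obtains \<mu> where "\<mu> > 0"
    and "\<And>z1 z2 A t0 t.
          \<lbrakk>\<And>t. t \<ge> t0 \<Longrightarrow> (z1 has_real_derivative \<omega> * z2 t) (at t within {t0..});
           \<And>t. t \<ge> t0 \<Longrightarrow> (z2 has_real_derivative - \<omega> * z1 t - A t * z2 t) (at t within {t0..});
           \<And>t. t \<ge> t0 \<Longrightarrow> amin \<le> A t \<and> A t \<le> amax; t0 \<le> t\<rbrakk>
          \<Longrightarrow> (z1 t)\<^sup>2 + (z2 t)\<^sup>2 \<le> 5 / 3 * ((z1 t0)\<^sup>2 + (z2 t0)\<^sup>2) * exp (- \<mu> * (t - t0))"
proof
  define \<epsilon> where "\<epsilon> = min (1 / 2) (min (amin / (2 * \<omega>)) (\<omega> / amax))"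
  define \<kappa> where "\<kappa> = min amin (\<epsilon> * \<omega> / 2)"
  have "\<epsilon> \<le> amin / (2 * \<omega>)" "\<epsilon> \<le> \<omega> / amax"
    unfolding \<epsilon>_def by (simp_all only: min.coboundedI2 min.cobounded1 min.cobounded2)
  then have \<epsilon>: "0 < \<epsilon>" "\<epsilon> \<le> 1 / 2" "2 * \<epsilon> * \<omega> \<le> amin" "\<epsilon> * amax \<le> \<omega>"
    using assms by (auto simp: \<epsilon>_def field_simps)
  have \<kappa>: "0 < \<kappa>" "\<kappa> \<le> amin" "\<kappa> \<le> \<epsilon> * \<omega> / 2"
    using assms \<epsilon> by (auto simp: \<kappa>_def)
  then show "4 / 5 * \<kappa> > 0" by simp
  fix z1 z2 A t0 t
  assume D1: "\<And>t. t \<ge> t0 \<Longrightarrow> (z1 has_real_derivative \<omega> * z2 t) (at t within {t0..})"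
    and D2: "\<And>t. t \<ge> t0 \<Longrightarrow> (z2 has_real_derivative - \<omega> * z1 t - A t * z2 t) (at t within {t0..})"
    and damping: "\<And>t. t \<ge> t0 \<Longrightarrow> amin \<le> A t \<and> A t \<le> amax" and "t0 \<le> t"
  have "2 * \<epsilon> * \<omega> \<le> A s \<and> \<epsilon> * A s \<le> \<omega> \<and> \<kappa> \<le> A s" if "t0 \<le> s" for s
  proof -
    have "amin \<le> A s" "\<epsilon> * A s \<le> \<epsilon> * amax"
      using damping[OF that] \<epsilon>(1) by simp_all
    then show ?thesis using \<epsilon> \<kappa> by linarith
  qed
  then show "(z1 t)\<^sup>2 + (z2 t)\<^sup>2 \<le> 5 / 3 * ((z1 t0)\<^sup>2 + (z2 t0)\<^sup>2) * exp (- (4 / 5 * \<kappa>) * (t - t0))"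
    using damped_oscillator_lyapunov_decay[OF D1 D2 \<open>\<omega> > 0\<close> \<epsilon>(1,2) \<kappa>(1) _ \<kappa>(3) \<open>t0 \<le> t\<close>]
    by blast
qed

section \<open>Existence for linear equations\<close>

lemma at_within_atLeastAtMost_eq_atLeast:
  fixes t :: real
  assumes "t < b"
  shows "at t within {a..b} = at t within {a..}"
  by (rule at_within_nhd[where S = "{..<b}"]) (use assms in auto)

text \<open>The terms of the Picard series, not its partial sums: the solution is \<open>\<Sum>n. picard L t0 y0 n t\<close>.\<close>

fun picard :: "(real \<Rightarrow> 'a::banach \<Rightarrow> 'a) \<Rightarrow> real \<Rightarrow> 'a \<Rightarrow> nat \<Rightarrow> real \<Rightarrow> 'a" where
  "picard L t0 y0 0 = (\<lambda>t. y0)"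
| "picard L t0 y0 (Suc n) = (\<lambda>t. integral {t0..t} (\<lambda>s. L s (picard L t0 y0 n s)))"

lemma continuous_on_picard:
  assumes "\<And>y b. continuous_on {t0..b} y \<Longrightarrow> continuous_on {t0..b} (\<lambda>t. L t (y t))"
  shows "continuous_on {t0..b} (picard L t0 y0 n)"
  by (induction n) (auto intro!: indefinite_integral_continuous_1 integrable_continuous_real assms)

lemma picard_norm_le:
  fixes L :: "real \<Rightarrow> 'a::banach \<Rightarrow> 'a"
  assumes bound: "\<And>t x. t \<ge> t0 \<Longrightarrow> norm (L t x) \<le> K * norm x" and "K \<ge> 0"
    and cont: "\<And>y b. continuous_on {t0..b} y \<Longrightarrow> continuous_on {t0..b} (\<lambda>t. L t (y t))"
    and "t0 \<le> t"
  shows "norm (picard L t0 y0 n t) \<le> norm y0 * (K * (t - t0)) ^ n / fact n"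
  using \<open>t0 \<le> t\<close>
proof (induction n arbitrary: t)
  case 0
  then show ?case by simp
next
  case (Suc n)
  define g where "g s = K * (norm y0 * (K * (s - t0)) ^ n / fact n)" for s
  define G where "G s = norm y0 * (K * (s - t0)) ^ Suc n / fact (Suc n)" for s
  have "(g has_integral (G t - G t0)) {t0..t}"
  proof (rule fundamental_theorem_of_calculus)
    fix s assume "s \<in> {t0..t}"
    have "(G has_real_derivative g s) (at s within {t0..t})"
      unfolding G_def g_def by (rule derivative_eq_intros refl | simp)+
    then show "(G has_vector_derivative g s) (at s within {t0..t})"
      by (simp add: has_real_derivative_iff_has_vector_derivative)
  qed fact
  then have "integral {t0..t} g = G t" by (simp add: G_def integral_unique)
  moreover have "norm (integral {t0..t} (\<lambda>s. L s (picard L t0 y0 n s))) \<le> integral {t0..t} g"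
  proof (rule integral_norm_bound_integral)
    show "(\<lambda>s. L s (picard L t0 y0 n s)) integrable_on {t0..t}"
      by (intro integrable_continuous_real cont continuous_on_picard)
    show "g integrable_on {t0..t}"
      unfolding g_def by (intro integrable_continuous_real continuous_intros) auto
    fix s assume "s \<in> {t0..t}"
    then have "norm (L s (picard L t0 y0 n s)) \<le> K * norm (picard L t0 y0 n s)" using bound by auto
    also have "\<dots> \<le> g s" unfolding g_def using Suc.IH[of s] \<open>s \<in> {t0..t}\<close> \<open>K \<ge> 0\<close> by (intro mult_left_mono) auto
    finally show "norm (L s (picard L t0 y0 n s)) \<le> g s" .
  qed
  ultimately show ?case by (simp add: G_def)
qed

lemma picard_at_start: "picard L t0 y0 n t0 = (if n = 0 then y0 else 0)"
  by (cases n) simp_all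

lemma uniform_limit_picard_series:
  fixes L :: "real \<Rightarrow> 'a::banach \<Rightarrow> 'a"
  assumes bound: "\<And>t x. t \<ge> t0 \<Longrightarrow> norm (L t x) \<le> K * norm x" and "K \<ge> 0"
    and cont: "\<And>y b. continuous_on {t0..b} y \<Longrightarrow> continuous_on {t0..b} (\<lambda>t. L t (y t))"
  shows "uniform_limit {t0..b} (\<lambda>n s. \<Sum>i<n. picard L t0 y0 i s) (\<lambda>s. \<Sum>n. picard L t0 y0 n s) sequentially"
proof (rule Weierstrass_m_test)
  show "norm (picard L t0 y0 n s) \<le> norm y0 * (K * (b - t0)) ^ n / fact n" if "s \<in> {t0..b}" for n s
  proof -
    have "norm (picard L t0 y0 n s) \<le> norm y0 * (K * (s - t0)) ^ n / fact n"
      using picard_norm_le[OF bound \<open>K \<ge> 0\<close> cont] that by auto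
    also have "\<dots> \<le> norm y0 * (K * (b - t0)) ^ n / fact n"
      using that \<open>K \<ge> 0\<close> by (intro divide_right_mono mult_left_mono power_mono) auto
    finally show ?thesis .
  qed
  show "summable (\<lambda>n. norm y0 * (K * (b - t0)) ^ n / fact n)"
    using summable_mult[OF summable_exp_generic[of "K * (b - t0)"], of "norm y0"]
    by (simp add: divide_inverse mult_ac)
qed

lemma picard_partial_sum_has_vector_derivative:
  fixes L :: "real \<Rightarrow> 'a::banach \<Rightarrow> 'a"
  assumes lin: "\<And>t. t \<ge> t0 \<Longrightarrow> linear (L t)"
    and cont: "\<And>y b. continuous_on {t0..b} y \<Longrightarrow> continuous_on {t0..b} (\<lambda>t. L t (y t))"
    and "t0 \<le> t" "t \<le> b"
  shows "((\<lambda>s. \<Sum>i<Suc n. picard L t0 y0 i s) has_vector_derivative L t (\<Sum>i<n. picard L t0 y0 i t))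
    (at t within {t0..b})"
proof (induction n)
  case 0
  show ?case using linear_0[OF lin[OF \<open>t0 \<le> t\<close>]] by (simp add: has_vector_derivative_const)
next
  case (Suc n)
  have "(picard L t0 y0 (Suc n) has_vector_derivative L t (picard L t0 y0 n t)) (at t within {t0..b})"
    using assms by (auto intro!: integral_has_vector_derivative cont continuous_on_picard)
  from has_vector_derivative_add[OF Suc.IH this] show ?case
    using linear_add[OF lin[OF \<open>t0 \<le> t\<close>]] by (simp add: add.commute)
qed

lemma picard_series_has_vector_derivative:
  fixes L :: "real \<Rightarrow> 'a::banach \<Rightarrow> 'a" and y0 :: 'a
  assumes lin: "\<And>t. t \<ge> t0 \<Longrightarrow> linear (L t)"
    and bound: "\<And>t x. t \<ge> t0 \<Longrightarrow> norm (L t x) \<le> K * norm x" and "K \<ge> 0"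
    and cont: "\<And>y b. continuous_on {t0..b} y \<Longrightarrow> continuous_on {t0..b} (\<lambda>t. L t (y t))"
    and "t0 \<le> t" "t \<le> b"
  defines "y \<equiv> \<lambda>t. \<Sum>n. picard L t0 y0 n t"
  shows "(y has_vector_derivative L t (y t)) (at t within {t0..b})"
proof -
  let ?S = "\<lambda>n s. \<Sum>i<n. picard L t0 y0 i s"
  have unif: "uniform_limit {t0..b} ?S y sequentially"
    unfolding y_def by (rule uniform_limit_picard_series[OF bound \<open>K \<ge> 0\<close> cont])
  have lim: "(\<lambda>n. ?S (Suc n) s) \<longlonglongrightarrow> y s" if "s \<in> {t0..b}" for s
    using tendsto_uniform_limitI[OF unif that] by (rule LIMSEQ_Suc)
  have "\<exists>g. \<forall>s\<in>{t0..b}. (\<lambda>n. ?S (Suc n) s) \<longlonglongrightarrow> g s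
      \<and> (g has_derivative (\<lambda>h. h *\<^sub>R L s (y s))) (at s within {t0..b})"
  proof (rule has_derivative_sequence[where f' = "\<lambda>n s h. h *\<^sub>R L s (?S n s)"])
    show "((\<lambda>s. ?S (Suc n) s) has_derivative (\<lambda>h. h *\<^sub>R L s (?S n s))) (at s within {t0..b})"
      if "s \<in> {t0..b}" for n s
      using picard_partial_sum_has_vector_derivative[OF lin cont, where t = s and b = b and n = n] that
      by (simp add: has_vector_derivative_def)
    show "\<forall>\<^sub>F n in sequentially. \<forall>s\<in>{t0..b}. \<forall>h.
        norm (h *\<^sub>R L s (?S n s) - h *\<^sub>R L s (y s)) \<le> e * norm h" if "e > 0" for e
    proof -
      have "\<forall>\<^sub>F n in sequentially. \<forall>s\<in>{t0..b}. dist (?S n s) (y s) < e / (K + 1)"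
        using uniform_limitD[OF unif] \<open>e > 0\<close> \<open>K \<ge> 0\<close> by simp
      then show ?thesis
      proof (rule eventually_mono, intro ballI allI)
        fix n s and h :: real assume close: "\<forall>s\<in>{t0..b}. dist (?S n s) (y s) < e / (K + 1)" and "s \<in> {t0..b}"
        have "norm (L s (?S n s - y s)) \<le> K * norm (?S n s - y s)"
          using bound \<open>s \<in> {t0..b}\<close> by simp
        also have "\<dots> \<le> K * (e / (K + 1))"
          using close \<open>s \<in> {t0..b}\<close> \<open>K \<ge> 0\<close> by (intro mult_left_mono) (auto simp: dist_norm less_imp_le)
        also have "\<dots> \<le> e" using \<open>e > 0\<close> \<open>K \<ge> 0\<close> by (simp add: field_simps)
        finally have "norm h * norm (L s (?S n s - y s)) \<le> norm h * e"
          by (rule mult_left_mono) simp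
        then show "norm (h *\<^sub>R L s (?S n s) - h *\<^sub>R L s (y s)) \<le> e * norm h"
          using linear_diff[OF lin, of s] \<open>s \<in> {t0..b}\<close>
          by (simp add: mult.commute flip: scaleR_diff_right)
      qed
    qed
    show "t \<in> {t0..b}" using assms by simp
    with lim show "(\<lambda>n. ?S (Suc n) t) \<longlonglongrightarrow> y t" .
  qed simp
  then obtain g where g: "\<And>s. s \<in> {t0..b} \<Longrightarrow> (\<lambda>n. ?S (Suc n) s) \<longlonglongrightarrow> g s
      \<and> (g has_derivative (\<lambda>h. h *\<^sub>R L s (y s))) (at s within {t0..b})"
    by blast
  have y_eq_g: "y s = g s" if "s \<in> {t0..b}" for s using g[OF that] lim[OF that] LIMSEQ_unique by blast
  have "(g has_derivative (\<lambda>h. h *\<^sub>R L t (y t))) (at t within {t0..b})" using g assms by auto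
  then have "(y has_derivative (\<lambda>h. h *\<^sub>R L t (y t))) (at t within {t0..b})"
    by (rule has_derivative_transform[rotated 2]) (use assms y_eq_g in auto)
  then show ?thesis by (simp add: has_vector_derivative_def)
qed

lemma linear_ode_exists:
  fixes L :: "real \<Rightarrow> 'a::banach \<Rightarrow> 'a"
  assumes lin: "\<And>t. t \<ge> t0 \<Longrightarrow> linear (L t)"
    and bound: "\<And>t x. t \<ge> t0 \<Longrightarrow> norm (L t x) \<le> K * norm x" and "K \<ge> 0"
    and cont: "\<And>y b. continuous_on {t0..b} y \<Longrightarrow> continuous_on {t0..b} (\<lambda>t. L t (y t))"
  obtains y where "y t0 = y0" "\<And>t. t \<ge> t0 \<Longrightarrow> (y has_vector_derivative L t (y t)) (at t within {t0..})"
proof -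
  define y where "y t = (\<Sum>n. picard L t0 y0 n t)" for t
  have "y t0 = y0"
    using sums_single[of 0 "\<lambda>_. y0"] by (simp add: y_def picard_at_start sums_iff)
  moreover have "(y has_vector_derivative L t (y t)) (at t within {t0..})" if "t0 \<le> t" for t
  proof -
    have "(y has_vector_derivative L t (y t)) (at t within {t0..t + 1})"
      unfolding y_def[abs_def] by (rule picard_series_has_vector_derivative[OF lin bound \<open>K \<ge> 0\<close> cont that]) simp_all
    then show ?thesis by (simp add: at_within_atLeastAtMost_eq_atLeast)
  qed
  ultimately show ?thesis using that by blast
qed

lemma affine_scalar_ode_exists:
  fixes q :: "real \<Rightarrow> real"
  assumes "continuous_on {t0..} q"
  obtains r where "r t0 = r0" "\<And>t. t \<ge> t0 \<Longrightarrow> (r has_real_derivative - h * r t + q t) (at t within {t0..})"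
proof -
  define I where "I t = integral {t0..t} (\<lambda>s. exp (h * (s - t0)) * q s)" for t
  define r where "r t = exp (- h * (t - t0)) * (r0 + I t)" for t
  have "(r has_real_derivative - h * r t + q t) (at t within {t0..})" if "t0 \<le> t" for t
  proof -
    have "continuous_on {t0..t + 1} (\<lambda>s. exp (h * (s - t0)) * q s)"
      by (intro continuous_intros continuous_on_subset[OF assms]) auto
    then have "(I has_real_derivative exp (h * (t - t0)) * q t) (at t within {t0..t + 1})"
      unfolding I_def[abs_def] using that by (intro integral_has_real_derivative) auto
    then have "(I has_real_derivative exp (h * (t - t0)) * q t) (at t within {t0..})"
      using at_within_atLeastAtMost_eq_atLeast[of t "t + 1" t0] by simp
    then have "(r has_real_derivative - h * exp (- h * (t - t0)) * (r0 + I t)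
        + exp (- h * (t - t0)) * (exp (h * (t - t0)) * q t)) (at t within {t0..})"
      unfolding r_def[abs_def] by (auto intro!: derivative_eq_intros)
    then show ?thesis by (rule DERIV_cong) (simp add: r_def exp_minus)
  qed
  moreover have "r t0 = r0" by (simp add: r_def I_def)
  ultimately show ?thesis using that by blast
qed

section \<open>Solutions of the system\<close>

lemma norm_triple_le: "norm (a, b, c) \<le> norm a + norm b + norm c"
  using norm_Pair_le[of a "(b, c)"] norm_Pair_le[of b c] by simp

lemma norm_le_norm_triple:
  fixes a :: "'a::real_normed_vector" and b :: "'b::real_normed_vector" and c :: "'c::real_normed_vector"
  shows "norm a \<le> norm (a, b, c)" "norm b \<le> norm (a, b, c)" "norm c \<le> norm (a, b, c)"
  using norm_fst_le[of a "(b, c)"] norm_snd_le[of "(b, c)" a] norm_fst_le[of b c] norm_snd_le[of c b]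
  by auto

lemma has_vector_derivative_Pair_iff:
  "((\<lambda>t. (f t, g t)) has_vector_derivative (f', g')) (at t within S)
    \<longleftrightarrow> (f has_vector_derivative f') (at t within S) \<and> (g has_vector_derivative g') (at t within S)"
proof
  assume "((\<lambda>t. (f t, g t)) has_vector_derivative (f', g')) (at t within S)"
  from bounded_linear.has_vector_derivative[OF bounded_linear_fst this]
    bounded_linear.has_vector_derivative[OF bounded_linear_snd this]
  show "(f has_vector_derivative f') (at t within S) \<and> (g has_vector_derivative g') (at t within S)"
    by simp
qed (auto intro: has_vector_derivative_Pair)

lemma J0_LambdaT_mult_nth:
  fixes z :: "real^2"
  shows "((J0 \<omega> + e *\<^sub>R LambdaT \<alpha>) *v z) $ 1 = \<omega> * z $ 2"
    and "((J0 \<omega> + e *\<^sub>R LambdaT \<alpha>) *v z) $ 2 = - \<omega> * z $ 1 - e * \<alpha> / 2 * z $ 2"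
  by (simp_all add: J0_def LambdaT_def matrix_vector_mult_def sum_2)

lemma inner_vec2: "x \<bullet> y = x $ 1 * y $ 1 + x $ 2 * y $ 2" for x y :: "real^2"
  by (simp add: inner_vec_def sum_2)

lemma norm_vec2_power2: "(norm x)\<^sup>2 = (x $ 1)\<^sup>2 + (x $ 2)\<^sup>2" for x :: "real^2"
  by (simp only: power2_norm_eq_inner inner_vec2) (simp add: power2_eq_square)

lemma sysf_apply:
  "sysf \<omega>0 \<alpha> \<omega>d h H (r, z, d) =
    (- h * r - H * (\<alpha> / 2 * exp d * (z $ 2)\<^sup>2),
     (J0 \<omega>0 + exp d *\<^sub>R LambdaT \<alpha>) *v z,
     - \<omega>d * (exp d - 1))"
proof -
  have "(J0 \<omega>0 + LambdaT \<alpha>) *v z + (exp d - 1) *\<^sub>R (LambdaT \<alpha> *v z) = (J0 \<omega>0 + exp d *\<^sub>R LambdaT \<alpha>) *v z"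
    by (simp add: vec_eq_iff forall_2 J0_def LambdaT_def matrix_vector_mult_def sum_2 algebra_simps)
  moreover have "z \<bullet> ((J0 \<omega>0 + exp d *\<^sub>R LambdaT \<alpha>) *v z) = - (\<alpha> / 2 * exp d * (z $ 2)\<^sup>2)"
    by (simp only: inner_vec2 J0_LambdaT_mult_nth) (simp add: power2_eq_square algebra_simps)
  ultimately show ?thesis by (simp add: sysf_def)
qed

lemma is_solution_sysf_iff:
  "is_solution (sysf \<omega>0 \<alpha> \<omega>d h H) t0 (\<lambda>t. (r t, z t, d t)) \<longleftrightarrow>
    (\<forall>t\<ge>t0.
      (r has_real_derivative - h * r t - H * (\<alpha> / 2 * exp (d t) * (z t $ 2)\<^sup>2)) (at t within {t0..}) \<and>
      (z has_vector_derivative (J0 \<omega>0 + exp (d t) *\<^sub>R LambdaT \<alpha>) *v z t) (at t within {t0..}) \<and>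
      (d has_real_derivative - \<omega>d * (exp (d t) - 1)) (at t within {t0..}))"
  by (simp add: is_solution_def sysf_apply has_vector_derivative_Pair_iff
      has_real_derivative_iff_has_vector_derivative)

lemma norm_J0_LambdaT_mult_le:
  fixes v :: "real^2"
  shows "norm ((J0 \<omega> + e *\<^sub>R LambdaT \<alpha>) *v v)
    \<le> (onorm ((*v) (J0 \<omega>)) + \<bar>e\<bar> * onorm ((*v) (LambdaT \<alpha>))) * norm v"
proof -
  have "norm ((J0 \<omega> + e *\<^sub>R LambdaT \<alpha>) *v v) \<le> norm (J0 \<omega> *v v) + \<bar>e\<bar> * norm (LambdaT \<alpha> *v v)"
    using norm_triangle_ineq[of "J0 \<omega> *v v" "e *\<^sub>R (LambdaT \<alpha> *v v)"]
    by (simp add: matrix_vector_mult_add_rdistrib flip: scaleR_matrix_vector_assoc)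
  also have "\<dots> \<le> onorm ((*v) (J0 \<omega>)) * norm v + \<bar>e\<bar> * (onorm ((*v) (LambdaT \<alpha>)) * norm v)"
    by (intro add_mono mult_left_mono onorm matrix_vector_mul_bounded_linear) auto
  finally show ?thesis by (simp add: algebra_simps)
qed

lemma has_vector_derivative_J0_LambdaT_nth:
  fixes z :: "real \<Rightarrow> real^2"
  assumes "(z has_vector_derivative (J0 \<omega> + e *\<^sub>R LambdaT \<alpha>) *v z t) F"
  shows "((\<lambda>t. z t $ 1) has_real_derivative \<omega> * z t $ 2) F"
    and "((\<lambda>t. z t $ 2) has_real_derivative - \<omega> * z t $ 1 - e * \<alpha> / 2 * z t $ 2) F"
  using bounded_linear.has_vector_derivative[OF bounded_linear_vec_nth assms, of 1]
    bounded_linear.has_vector_derivative[OF bounded_linear_vec_nth assms, of 2]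
  by (simp_all add: has_real_derivative_iff_has_vector_derivative J0_LambdaT_mult_nth)

locale sysf_solution =
  fixes \<omega>0 \<alpha> \<omega>d h H t0 :: real
    and r :: "real \<Rightarrow> real" and z :: "real \<Rightarrow> real^2" and d :: "real \<Rightarrow> real"
  assumes pos: "\<omega>0 > 0" "\<alpha> > 0" "\<omega>d > 0" "h > 0" "H > 0"
    and solution: "is_solution (sysf \<omega>0 \<alpha> \<omega>d h H) t0 (\<lambda>t. (r t, z t, d t))"
begin

lemma r_deriv: "t \<ge> t0 \<Longrightarrow>
    (r has_real_derivative - h * r t - H * (\<alpha> / 2 * exp (d t) * (z t $ 2)\<^sup>2)) (at t within {t0..})"
  and z_deriv: "t \<ge> t0 \<Longrightarrow>
    (z has_vector_derivative (J0 \<omega>0 + exp (d t) *\<^sub>R LambdaT \<alpha>) *v z t) (at t within {t0..})"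
  and d_deriv: "t \<ge> t0 \<Longrightarrow> (d has_real_derivative - \<omega>d * (exp (d t) - 1)) (at t within {t0..})"
  using solution by (simp_all add: is_solution_sysf_iff)

lemmas z1_deriv = has_vector_derivative_J0_LambdaT_nth(1)[OF z_deriv]
  and z2_deriv = has_vector_derivative_J0_LambdaT_nth(2)[OF z_deriv]

lemma norm_z_power2_deriv: "t \<ge> t0 \<Longrightarrow>
    ((\<lambda>t. (norm (z t))\<^sup>2) has_real_derivative - 2 * (\<alpha> / 2 * exp (d t) * (z t $ 2)\<^sup>2)) (at t within {t0..})"
  unfolding norm_vec2_power2 using z1_deriv z2_deriv
  by (auto intro!: derivative_eq_intros simp: power2_eq_square algebra_simps)

lemma d_abs_le: "t0 \<le> t \<Longrightarrow> \<bar>d t\<bar> \<le> \<bar>d t0\<bar>"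
  using exp_relaxation_abs_le[OF d_deriv] pos by simp

lemma d_abs_exp_decay: "t0 \<le> t \<Longrightarrow> \<bar>d t\<bar> \<le> exp (2 * \<bar>d t0\<bar>) * exp (- \<omega>d * (t - t0))"
  using exp_relaxation_exp_decay[OF d_deriv] pos by simp

lemma norm_z_nonincreasing:
  assumes "t0 \<le> s" "s \<le> t"
  shows "norm (z t) \<le> norm (z s)"
proof -
  have "(norm (z t))\<^sup>2 \<le> (norm (z s))\<^sup>2"
    unfolding norm_vec2_power2
    by (rule damped_oscillator_energy_nonincreasing[OF z1_deriv z2_deriv]) (use assms pos in auto)
  then show ?thesis by (simp add: power2_le_iff_abs_le)
qed

lemma r_abs_le:
  assumes "t0 \<le> t1" "t1 \<le> t"
  shows "\<bar>r t\<bar> \<le> (\<bar>r t1\<bar> + H / 2 * (norm (z t1))\<^sup>2) * exp (- h * (t - t1)) + H * (norm (z t1))\<^sup>2"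
  by (rule forced_relaxation_abs_le[OF r_deriv norm_z_power2_deriv]) (use assms pos in auto)

lemma norm_le:
  assumes "t0 \<le> t"
  shows "norm (r t, z t, d t) \<le> 3 * norm (r t0, z t0, d t0) + 3 * H / 2 * (norm (r t0, z t0, d t0))\<^sup>2"
proof -
  let ?n = "norm (r t0, z t0, d t0)"
  have r0: "\<bar>r t0\<bar> \<le> ?n" and z0: "norm (z t0) \<le> ?n" and d0: "\<bar>d t0\<bar> \<le> ?n"
    using norm_le_norm_triple[where a = "r t0" and b = "z t0" and c = "d t0"] by auto
  then have "3 * H / 2 * (norm (z t0))\<^sup>2 \<le> 3 * H / 2 * ?n\<^sup>2"
    using pos by (intro mult_left_mono power_mono) auto
  moreover have "\<bar>r t\<bar> \<le> \<bar>r t0\<bar> + 3 * H / 2 * (norm (z t0))\<^sup>2"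
  proof -
    have "exp (- h * (t - t0)) \<le> 1" using assms pos by simp
    then have "(\<bar>r t0\<bar> + H / 2 * (norm (z t0))\<^sup>2) * exp (- h * (t - t0)) \<le> \<bar>r t0\<bar> + H / 2 * (norm (z t0))\<^sup>2"
      using pos by (intro mult_left_le) auto
    then show ?thesis using r_abs_le[of t0 t] assms by simp
  qed
  moreover have "norm (r t, z t, d t) \<le> \<bar>r t\<bar> + norm (z t) + \<bar>d t\<bar>"
    using norm_triple_le[of "r t" "z t" "d t"] by simp
  ultimately show ?thesis
    using norm_z_nonincreasing[of t0 t] d_abs_le[of t] r0 z0 d0 assms by linarith
qed

lemma damping_bounds:
  assumes "\<bar>d t0\<bar> < c" "t0 \<le> t"
  shows "exp (- c) * \<alpha> / 2 \<le> exp (d t) * \<alpha> / 2 \<and> exp (d t) * \<alpha> / 2 \<le> exp c * \<alpha> / 2"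
proof -
  have "exp (- c) \<le> exp (d t)" "exp (d t) \<le> exp c"
    using d_abs_le[OF \<open>t0 \<le> t\<close>] assms(1) by auto
  then show ?thesis using pos by (simp add: divide_right_mono)
qed

lemma r_abs_le_midpoint:
  assumes "norm (r t0, z t0, d t0) < c" "t0 \<le> t"
  shows "\<bar>r t\<bar> \<le> (3 * c + 2 * H * c\<^sup>2) * exp (- h * ((t - t0) / 2)) + H * (norm (z ((t0 + t) / 2)))\<^sup>2"
proof -
  define t1 where "t1 = (t0 + t) / 2"
  have "t0 \<le> t1" "t1 \<le> t" "t - t1 = (t - t0) / 2" using \<open>t0 \<le> t\<close> by (simp_all add: t1_def field_simps)
  have "\<bar>r t1\<bar> \<le> 3 * norm (r t0, z t0, d t0) + 3 * H / 2 * (norm (r t0, z t0, d t0))\<^sup>2"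
    using norm_le[OF \<open>t0 \<le> t1\<close>] norm_le_norm_triple(1)[where a = "r t1" and b = "z t1" and c = "d t1"] by simp
  also have "\<dots> \<le> 3 * c + 3 * H / 2 * c\<^sup>2"
    using assms pos by (intro add_mono mult_left_mono power_mono) auto
  finally have "\<bar>r t1\<bar> \<le> 3 * c + 3 * H / 2 * c\<^sup>2" .
  moreover have "H / 2 * (norm (z t1))\<^sup>2 \<le> H / 2 * c\<^sup>2"
    using norm_z_nonincreasing[OF order_refl \<open>t0 \<le> t1\<close>] norm_le_norm_triple(2)[where a = "r t0" and b = "z t0" and c = "d t0"]
      assms pos by (intro mult_left_mono power_mono) auto
  ultimately have "(\<bar>r t1\<bar> + H / 2 * (norm (z t1))\<^sup>2) * exp (- h * (t - t1))
      \<le> (3 * c + 2 * H * c\<^sup>2) * exp (- h * (t - t1))"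
    by (intro mult_right_mono) auto
  then show ?thesis
    using r_abs_le[OF \<open>t0 \<le> t1\<close> \<open>t1 \<le> t\<close>]
    unfolding t1_def[symmetric] \<open>t - t1 = (t - t0) / 2\<close>[symmetric] by linarith
qed

end

lemma sysf_solution_of_is_solution:
  assumes "\<omega>0 > 0" "\<alpha> > 0" "\<omega>d > 0" "h > 0" "H > 0" "is_solution (sysf \<omega>0 \<alpha> \<omega>d h H) t0 x"
  shows "sysf_solution \<omega>0 \<alpha> \<omega>d h H t0 (\<lambda>t. fst (x t)) (\<lambda>t. fst (snd (x t))) (\<lambda>t. snd (snd (x t)))"
  using assms by unfold_locales simp_all

lemma sysf_solution_norm_le:
  assumes "\<omega>0 > 0" "\<alpha> > 0" "\<omega>d > 0" "h > 0" "H > 0"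
    and "is_solution (sysf \<omega>0 \<alpha> \<omega>d h H) t0 x" "t0 \<le> t"
  shows "norm (x t) \<le> 3 * norm (x t0) + 3 * H / 2 * (norm (x t0))\<^sup>2"
  using sysf_solution.norm_le[OF sysf_solution_of_is_solution[OF assms(1-6)] \<open>t0 \<le> t\<close>] by simp

lemma sysf_solution_uniform_decay:
  fixes \<omega>0 \<alpha> \<omega>d h H c :: real
  assumes pos: "\<omega>0 > 0" "\<alpha> > 0" "\<omega>d > 0" "h > 0" "H > 0" and "c > 0"
  shows "\<exists>\<beta>. (\<beta> \<longlongrightarrow> 0) at_top \<and> (\<forall>t0 x t. is_solution (sysf \<omega>0 \<alpha> \<omega>d h H) t0 x \<longrightarrow>
    norm (x t0) < c \<longrightarrow> t0 \<le> t \<longrightarrow> norm (x t) \<le> \<beta> (t - t0))"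
proof -
  obtain \<mu> where "\<mu> > 0" and oscillator_decay: "\<And>z1 z2 A t0 t.
          \<lbrakk>\<And>t. t \<ge> t0 \<Longrightarrow> (z1 has_real_derivative \<omega>0 * z2 t) (at t within {t0..});
           \<And>t. t \<ge> t0 \<Longrightarrow> (z2 has_real_derivative - \<omega>0 * z1 t - A t * z2 t) (at t within {t0..});
           \<And>t. t \<ge> t0 \<Longrightarrow> exp (- c) * \<alpha> / 2 \<le> A t \<and> A t \<le> exp c * \<alpha> / 2; t0 \<le> t\<rbrakk>
          \<Longrightarrow> (z1 t)\<^sup>2 + (z2 t)\<^sup>2 \<le> 5 / 3 * ((z1 t0)\<^sup>2 + (z2 t0)\<^sup>2) * exp (- \<mu> * (t - t0))"
    by (rule damped_oscillator_exp_decay[of \<omega>0 "exp (- c) * \<alpha> / 2" "exp c * \<alpha> / 2"])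
       (use pos \<open>c > 0\<close> in auto)
  define \<beta> where "\<beta> s = exp (2 * c) * exp (- \<omega>d * s) + sqrt (5 / 3 * c\<^sup>2 * exp (- \<mu> * s))
      + (3 * c + 2 * H * c\<^sup>2) * exp (- h * (s / 2)) + H * (5 / 3 * c\<^sup>2 * exp (- \<mu> * (s / 2)))" for s
  have "(\<beta> \<longlongrightarrow> 0) at_top"
    unfolding \<beta>_def using pos \<open>\<mu> > 0\<close> \<open>c > 0\<close> by (intro tendsto_add_zero; real_asymp)
  moreover have "norm (x t) \<le> \<beta> (t - t0)"
    if sol: "is_solution (sysf \<omega>0 \<alpha> \<omega>d h H) t0 x" and "norm (x t0) < c" "t0 \<le> t" for t0 x t
  proof -
    define r where "r = (\<lambda>t. fst (x t))"
    define z where "z = (\<lambda>t. fst (snd (x t)))"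
    define d where "d = (\<lambda>t. snd (snd (x t)))"
    interpret sysf_solution \<omega>0 \<alpha> \<omega>d h H t0 r z d
      using sysf_solution_of_is_solution[OF pos sol] by (simp add: r_def z_def d_def)
    have x_eq: "x s = (r s, z s, d s)" for s by (simp add: r_def z_def d_def)
    have "\<bar>d t0\<bar> < c" "norm (z t0) < c"
      using \<open>norm (x t0) < c\<close> norm_le_norm_triple[where a = "r t0" and b = "z t0" and c = "d t0"] by (auto simp: x_eq)
    have z_decay: "(norm (z s))\<^sup>2 \<le> 5 / 3 * c\<^sup>2 * exp (- \<mu> * (s - t0))" if "t0 \<le> s" for s
    proof -
      have "(norm (z s))\<^sup>2 \<le> 5 / 3 * (norm (z t0))\<^sup>2 * exp (- \<mu> * (s - t0))"
        unfolding norm_vec2_power2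
        by (rule oscillator_decay[OF z1_deriv z2_deriv damping_bounds[OF \<open>\<bar>d t0\<bar> < c\<close>] that])
      also have "\<dots> \<le> 5 / 3 * c\<^sup>2 * exp (- \<mu> * (s - t0))"
        using \<open>norm (z t0) < c\<close> by (intro mult_right_mono mult_left_mono power_mono) auto
      finally show ?thesis .
    qed
    have "\<bar>d t\<bar> \<le> exp (2 * \<bar>d t0\<bar>) * exp (- \<omega>d * (t - t0))" by (rule d_abs_exp_decay[OF \<open>t0 \<le> t\<close>])
    also have "\<dots> \<le> exp (2 * c) * exp (- \<omega>d * (t - t0))"
      using \<open>\<bar>d t0\<bar> < c\<close> by (intro mult_right_mono) auto
    finally have "\<bar>d t\<bar> \<le> exp (2 * c) * exp (- \<omega>d * (t - t0))" .
    moreover have "norm (z t) \<le> sqrt (5 / 3 * c\<^sup>2 * exp (- \<mu> * (t - t0)))"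
      using z_decay[OF \<open>t0 \<le> t\<close>] by (simp add: real_le_rsqrt)
    moreover have "H * (norm (z ((t0 + t) / 2)))\<^sup>2 \<le> H * (5 / 3 * c\<^sup>2 * exp (- \<mu> * ((t - t0) / 2)))"
      using z_decay[of "(t0 + t) / 2"] \<open>t0 \<le> t\<close> pos by (simp add: field_simps)
    ultimately show ?thesis
      using norm_triple_le[of "r t" "z t" "d t"] r_abs_le_midpoint[OF _ \<open>t0 \<le> t\<close>] \<open>norm (x t0) < c\<close>
      by (fastforce simp: x_eq \<beta>_def)
  qed
  ultimately show ?thesis by blast
qed

lemma sysf_solution_exists:
  fixes \<omega>0 \<alpha> \<omega>d h H :: real
  assumes "\<omega>d > 0"
  obtains x where "x t0 = x0" "is_solution (sysf \<omega>0 \<alpha> \<omega>d h H) t0 x"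
proof -
  obtain r0 z0 d0 where x0: "x0 = (r0, z0, d0)" by (cases x0)
  obtain d where "d t0 = d0"
    and d_deriv: "\<And>t. t \<ge> t0 \<Longrightarrow> (d has_real_derivative - \<omega>d * (exp (d t) - 1)) (at t within {t0..})"
    using exp_relaxation_exists[OF less_imp_le[OF assms], of t0 d0] by blast
  have d_cont: "continuous_on {t0..} d"
    unfolding continuous_on_eq_continuous_within using d_deriv DERIV_continuous by blast
  define M where "M t = J0 \<omega>0 + exp (d t) *\<^sub>R LambdaT \<alpha>" for t
  define K where "K = onorm ((*v) (J0 \<omega>0)) + exp \<bar>d0\<bar> * onorm ((*v) (LambdaT \<alpha>))"
  have "K \<ge> 0" by (simp add: K_def onorm_pos_le)
  have M_bound: "norm (M t *v v) \<le> K * norm v" if "t \<ge> t0" for t v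
  proof -
    have "exp (d t) \<le> exp \<bar>d0\<bar>"
      using exp_relaxation_abs_le[OF d_deriv _ that] assms \<open>d t0 = d0\<close> by simp
    then have "onorm ((*v) (J0 \<omega>0)) + \<bar>exp (d t)\<bar> * onorm ((*v) (LambdaT \<alpha>)) \<le> K"
      by (simp add: K_def mult_right_mono onorm_pos_le)
    then show ?thesis
      using norm_J0_LambdaT_mult_le[of \<omega>0 "exp (d t)" \<alpha> v] by (simp add: M_def mult_right_mono order_trans)
  qed
  have M_cont: "continuous_on {t0..b} (\<lambda>t. M t *v y t)" if "continuous_on {t0..b} y" for y b
    unfolding M_def matrix_vector_mult_add_rdistrib scaleR_matrix_vector_assoc[symmetric]
    by (intro continuous_intros continuous_on_subset[OF d_cont] that
        bounded_linear.continuous_on[OF matrix_vector_mul_bounded_linear]) auto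
  obtain z where "z t0 = z0"
    and z_deriv: "\<And>t. t \<ge> t0 \<Longrightarrow> (z has_vector_derivative M t *v z t) (at t within {t0..})"
    using linear_ode_exists[of t0 _ K z0, OF matrix_vector_mul_linear M_bound \<open>K \<ge> 0\<close> M_cont] by blast
  have z_cont: "continuous_on {t0..} z"
    unfolding continuous_on_eq_continuous_within using z_deriv has_vector_derivative_continuous by blast
  have q_cont: "continuous_on {t0..} (\<lambda>t. - H * (\<alpha> / 2 * exp (d t) * (z t $ 2)\<^sup>2))"
    by (intro continuous_intros d_cont bounded_linear.continuous_on[OF bounded_linear_vec_nth z_cont])
  obtain r where "r t0 = r0"
    and r_deriv: "\<And>t. t \<ge> t0 \<Longrightarrow> (r has_real_derivative
        - h * r t + (- H * (\<alpha> / 2 * exp (d t) * (z t $ 2)\<^sup>2))) (at t within {t0..})"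
    using affine_scalar_ode_exists[OF q_cont, of r0 h] by blast
  have "is_solution (sysf \<omega>0 \<alpha> \<omega>d h H) t0 (\<lambda>t. (r t, z t, d t))"
    unfolding is_solution_sysf_iff using r_deriv z_deriv d_deriv by (simp add: M_def)
  moreover have "(r t0, z t0, d t0) = x0" using x0 \<open>r t0 = r0\<close> \<open>z t0 = z0\<close> \<open>d t0 = d0\<close> by simp
  ultimately show ?thesis by (intro that[of "\<lambda>t. (r t, z t, d t)"]) simp_all
qed

section \<open>Global uniform asymptotic stability\<close>

lemma GUAS_intro:
  fixes f :: "'a::real_normed_vector \<Rightarrow> 'a" and \<alpha> :: "real \<Rightarrow> real"
  assumes "f 0 = 0"
    and exists: "\<And>t0 x0. \<exists>x. x t0 = x0 \<and> is_solution f t0 x"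
    and bound: "\<And>t0 x t. is_solution f t0 x \<Longrightarrow> t0 \<le> t \<Longrightarrow> norm (x t) \<le> \<alpha> (norm (x t0))"
    and \<alpha>: "mono_on {0..} \<alpha>" "isCont \<alpha> 0" "\<alpha> 0 = 0"
    and decay: "\<And>c. c > 0 \<Longrightarrow> \<exists>\<beta>. (\<beta> \<longlongrightarrow> 0) at_top \<and>
      (\<forall>t0 x t. is_solution f t0 x \<longrightarrow> norm (x t0) < c \<longrightarrow> t0 \<le> t \<longrightarrow> norm (x t) \<le> \<beta> (t - t0))"
  shows "GUAS f"
  unfolding GUAS_def
proof (intro conjI allI impI)
  show "f 0 = 0" "\<exists>x. x t0 = x0 \<and> is_solution f t0 x" for t0 x0 by fact+
next
  fix \<epsilon> :: real assume "\<epsilon> > 0"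
  then obtain \<delta> where "\<delta> > 0" and \<delta>: "\<And>n. \<bar>n\<bar> < \<delta> \<Longrightarrow> \<bar>\<alpha> n\<bar> < \<epsilon>"
    using \<open>isCont \<alpha> 0\<close> \<open>\<alpha> 0 = 0\<close> unfolding continuous_at_eps_delta dist_real_def by force
  have "norm (x t) < \<epsilon>" if "is_solution f t0 x" "norm (x t0) < \<delta>" "t0 \<le> t" for t0 x t
    using bound[OF that(1,3)] \<delta>[of "norm (x t0)"] that(2) by auto
  with \<open>\<delta> > 0\<close> show "\<exists>\<delta>>0. \<forall>t0 x. is_solution f t0 x \<and> norm (x t0) < \<delta> \<longrightarrow> (\<forall>t\<ge>t0. norm (x t) < \<epsilon>)"
    by blast
next
  fix c :: real assume "c > 0"
  have "norm (x t) \<le> \<alpha> c" if "is_solution f t0 x" "norm (x t0) < c" "t0 \<le> t" for t0 x t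
    using bound[OF that(1,3)] mono_onD[OF \<alpha>(1), of "norm (x t0)" c] that(2) \<open>c > 0\<close> by auto
  then show "\<exists>B. \<forall>t0 x. is_solution f t0 x \<and> norm (x t0) < c \<longrightarrow> (\<forall>t\<ge>t0. norm (x t) \<le> B)"
    by blast
next
  fix c \<eta> :: real assume "c > 0" "\<eta> > 0"
  obtain \<beta> where lim: "(\<beta> \<longlongrightarrow> 0) at_top" and \<beta>: "\<And>t0 x t. is_solution f t0 x \<Longrightarrow> norm (x t0) < c \<Longrightarrow>
      t0 \<le> t \<Longrightarrow> norm (x t) \<le> \<beta> (t - t0)"
    using decay[OF \<open>c > 0\<close>] by blast
  obtain T where T: "\<And>s. s \<ge> T \<Longrightarrow> \<beta> s < \<eta>"
    using order_tendstoD(2)[OF lim \<open>\<eta> > 0\<close>] unfolding eventually_at_top_linorder by blast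
  have "norm (x t) < \<eta>" if "is_solution f t0 x" "norm (x t0) < c" "t \<ge> t0 + max 0 T" for t0 x t
  proof -
    have "t0 \<le> t" "T \<le> t - t0" using that(3) by linarith+
    with \<beta>[OF that(1,2)] T show ?thesis by (meson order.strict_trans1)
  qed
  then show "\<exists>T\<ge>0. \<forall>t0 x. is_solution f t0 x \<and> norm (x t0) < c \<longrightarrow> (\<forall>t\<ge>t0 + T. norm (x t) < \<eta>)"
    by (intro exI[of _ "max 0 T"]) auto
qed

theorem mainTheorem5:
  fixes \<omega>0 \<alpha> \<omega>d h H :: real
  assumes "\<omega>0 > 0" "\<alpha> > 0" "\<omega>d > 0" "h > 0" "H > 0"
  shows "GUAS (sysf \<omega>0 \<alpha> \<omega>d h H)"
proof (rule GUAS_intro[where \<alpha> = "\<lambda>n. 3 * n + 3 * H / 2 * n\<^sup>2"])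
  show "sysf \<omega>0 \<alpha> \<omega>d h H 0 = 0" by (simp add: sysf_def zero_prod_def)
  show "\<exists>x. x t0 = x0 \<and> is_solution (sysf \<omega>0 \<alpha> \<omega>d h H) t0 x" for t0 x0
    using sysf_solution_exists[OF \<open>\<omega>d > 0\<close>] by blast
  show "norm (x t) \<le> 3 * norm (x t0) + 3 * H / 2 * (norm (x t0))\<^sup>2"
    if "is_solution (sysf \<omega>0 \<alpha> \<omega>d h H) t0 x" "t0 \<le> t" for t0 x t
    by (rule sysf_solution_norm_le[OF assms that])
  show "mono_on {0..} (\<lambda>n. 3 * n + 3 * H / 2 * n\<^sup>2)"
    using \<open>H > 0\<close> by (auto intro!: mono_onI add_mono mult_left_mono power_mono)
  show "\<exists>\<beta>. (\<beta> \<longlongrightarrow> 0) at_top \<and> (\<forall>t0 x t. is_solution (sysf \<omega>0 \<alpha> \<omega>d h H) t0 x \<longrightarrow>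
      norm (x t0) < c \<longrightarrow> t0 \<le> t \<longrightarrow> norm (x t) \<le> \<beta> (t - t0))" if "c > 0" for c
    by (rule sysf_solution_uniform_decay[OF assms that])
qed (simp_all add: continuous_intros)

end
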